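(* Let $\mu\in\mathcal{M}_{\mathbb{T}}^\times$ and $t>1$. The function $\omega_t$ is the $\eta$-transform of some $\boxtimes$-infinitely divisible measure in $\mathcal{M}_{\mathbb{T}}^\times$.
   Context: $\mathbb{D}$ is the open unit disc, $\mathbb{T}$ the unit circle. For a Borel probability measure $\mu$ on $\mathbb{T}$ and $z\in\mathbb{D}$: $\psi_\mu(z)=\int\frac{zs}{1-zs}\,d\mu(s)$, $\eta_\mu=\psi_\mu/(1+\psi_\mu)$ (the $\eta$-transform). $\mathcal{M}_{\mathbb{T}}^\times$ is the set of Borel probability measures on $\mathbb{T}$ with nonzero first moment $\eta_\mu'(0)=\int\zeta\,d\mu(\zeta)$ and such that $\eta_\mu$ does not vanish on $\mathbb{D}\setminus\{0\}$. For measures with nonzero first moment, $\Sigma_\mu(z)=\eta_\mu^{-1}(z)/z$ near $z=0$, and the multiplicative free convolution is characterized by $\Sigma_{\mu\boxtimes\nu}=\Sigma_\mu\Sigma_\nu$ near $0$. A measure $\nu$ is $\boxtimes$-infinitely divisible if for every positive integer $n$ there is a measure $\nu_n$ with $\nu=\nu_n\boxtimes\cdots\boxtimes\nu_n$ ($n$ factors). For $\mu\in\mathcal{M}_{\mathbb{T}}^\times$ there is an analytic $u:\mathbb{D}\to\mathbb{C}$ with $\Re u\ge0$ and $\eta_\mu(z)=z\exp[-u(z)]$; it is fixed, normalized by $-\Im u(0)=\arg\eta_\mu'(0)\in[-\pi,\pi]$. For $t>1$ let $\Phi_t(z)=z\exp[(t-1)u(z)]$, $z\in\mathbb{D}$.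 The function $\omega_t:\overline{\mathbb{D}}\to\overline{\mathbb{D}}$ is the continuous function, analytic on $\mathbb{D}$, with $\omega_t(0)=0$, $\omega_t(\mathbb D)\subset\mathbb D$ and $\Phi_t(\omega_t(z))=z$ for $z\in\mathbb{D}$. *)

theory Defs
  imports "HOL-Probability.Probability" "HOL-Complex_Analysis.Complex_Analysis"
begin

definition circle_prob :: "complex measure set" where
  "circle_prob = {M. prob_space M \<and> sets M = sets (restrict_space borel (sphere 0 1))}"

definition first_moment :: "complex measure \<Rightarrow> complex" where
  "first_moment M = (\<integral>s. s \<partial>M)"

definition psi_transform :: "complex measure \<Rightarrow> complex \<Rightarrow> complex" where
  "psi_transform M z = (\<integral>s. z * s / (1 - z * s) \<partial>M)"

(* On the unit disc Re (psi) > -1/2, so the denominator does not vanish there. *)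
definition eta_transform :: "complex measure \<Rightarrow> complex \<Rightarrow> complex" where
  "eta_transform M z = psi_transform M z / (1 + psi_transform M z)"

(* The class of measures written M_T with superscript "times". *)
definition circle_prob_times :: "complex measure set" where
  "circle_prob_times = {M \<in> circle_prob. first_moment M \<noteq> 0 \<and>
     (\<forall>z \<in> ball 0 1 - {0}. eta_transform M z \<noteq> 0)}"

(* Compositional inverse of the eta-transform at the origin. It exists when the first moment is
   nonzero and is then unique as a germ at 0; only its values near 0 are meaningful. *)
definition eta_inverse :: "complex measure \<Rightarrow> complex \<Rightarrow> complex" where
  "eta_inverse M = (SOME g. g 0 = 0 \<and> (\<exists>r>0. g holomorphic_on ball 0 r \<and>
     (\<forall>z \<in> ball 0 r. g z \<in> ball 0 1 \<and> eta_transform M (g z) = z)))"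

definition Sigma_transform :: "complex measure \<Rightarrow> complex \<Rightarrow> complex" where
  "Sigma_transform M z = eta_inverse M z / z"

(* Meaningful for measures on the circle with nonzero first moments. The filter "at 0" is punctured,
   so the removable singularity of the Sigma-transforms at 0 plays no role. *)
definition free_mult_conv :: "complex measure \<Rightarrow> complex measure \<Rightarrow> complex measure"
    (infixr "\<boxtimes>" 70) where
  "M \<boxtimes> N = (THE R. R \<in> circle_prob \<and> first_moment R \<noteq> 0 \<and>
     (\<forall>\<^sub>F z in at 0. Sigma_transform R z = Sigma_transform M z * Sigma_transform N z))"

(* The n-1 applications give a product of n factors R. The factor R is required to have nonzero
   first moment, so that the Sigma-transform characterization of the convolution applies; this is no
   restriction when N has nonzero first moment, as first moments multiply under free convolution. *)
definition free_mult_inf_divisible :: "complex measure \<Rightarrow> bool" where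
  "free_mult_inf_divisible N \<longleftrightarrow>
     (\<forall>n::nat. n \<ge> 1 \<longrightarrow> (\<exists>R \<in> circle_prob. first_moment R \<noteq> 0 \<and>
        N = (((\<boxtimes>) R) ^^ (n - 1)) R))"

(* For negative real first moment both arguments pi and -pi are allowed. *)
definition eta_exponent :: "complex measure \<Rightarrow> (complex \<Rightarrow> complex) \<Rightarrow> bool" where
  "eta_exponent M u \<longleftrightarrow> u holomorphic_on ball 0 1 \<and>
     (\<forall>z \<in> ball 0 1. Re (u z) \<ge> 0 \<and> eta_transform M z = z * exp (- u z)) \<and>
     is_Arg (first_moment M) (- Im (u 0)) \<and> - Im (u 0) \<in> {-pi..pi}"

definition Phi :: "(complex \<Rightarrow> complex) \<Rightarrow> real \<Rightarrow> complex \<Rightarrow> complex" where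
  "Phi u t z = z * exp (of_real (t - 1) * u z)"

(* These properties determine w on the closed unit disc; its values elsewhere are irrelevant. *)
definition is_omega :: "(complex \<Rightarrow> complex) \<Rightarrow> real \<Rightarrow> (complex \<Rightarrow> complex) \<Rightarrow> bool" where
  "is_omega u t w \<longleftrightarrow> continuous_on (cball 0 1) w \<and> w ` cball 0 1 \<subseteq> cball 0 1 \<and>
     w holomorphic_on ball 0 1 \<and> w 0 = 0 \<and> w ` ball 0 1 \<subseteq> ball 0 1 \<and>
     (\<forall>z \<in> ball 0 1. Phi u t (w z) = z)"

end

theory Submission
  imports Defs
begin

text \<open>A holomorphic self-map w of the disc with w(0) = 0 is the eta-transform of a probability measure:
  eta = w amounts to an integral representation of (1 + w)/(1 - w), which has nonnegative real part
  (Herglotz). So omega_t is an eta-transform, with local inverse Phi_t and Sigma-transform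
  exp((t - 1) u). For every s > 1 the map Phi_s has a holomorphic right inverse on the disc, giving
  a measure nu_s with Sigma-transform exp((s - 1) u). As moments determine a measure on the circle,
  nu_s is determined by its Sigma-transform, so the free powers of nu_s with s = 1 + (t - 1)/n run
  through the measures nu_{1 + k (t - 1)/n}; for k = n one reaches nu_t.\<close>

section \<open>The Herglotz representation\<close>

text \<open>The product in \<open>free_mult_conv\<close> is a definite description, so it can be
  computed only after a measure with the right Sigma-transform has been exhibited and shown to be
  unique. This is why the whole family nu_s is constructed, and not just nu_t and its n-th root:
  every partial product has to be such a measure. The construction works for all s > 1 alike,
  because s enters only as the positive factor s - 1 of u, and Re u \<ge> 0 then gives |Phi_s(w)|
  \<ge> |w|. In the Herglotz step the obstacle is that the function may have no boundary values on
  the circle; smaller circles supply probability measures, and compactness supplies their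
  limit.\<close>

lemma has_integral_circle_mean:
  fixes H :: "complex \<Rightarrow> complex"
  assumes "continuous_on (cball 0 1) H" "H holomorphic_on ball 0 1"
  shows "((\<lambda>\<theta>. H (cis \<theta>)) has_integral 2 * pi * H 0) {0..2 * pi}"
proof -
  have "((\<lambda>u. H u / (u - 0)) has_contour_integral (2 * of_real pi * \<i> * H 0)) (circlepath 0 1)"
    by (rule Cauchy_integral_circlepath) (use assms in auto)
  then have "((\<lambda>\<theta>. H (cis \<theta>) * \<i>) has_integral (2 * of_real pi * \<i> * H 0)) {0..2 * pi}"
    unfolding circlepath_def by (subst (asm) has_contour_integral_part_circlepath_iff) auto
  from has_integral_mult_left[OF this, of "- \<i>"] show ?thesis
    by (simp add: mult_ac flip: mult.assoc[of "\<i>" "\<i>"])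
qed

text \<open>Since (c + z)/(c - z) = 2 c/(c - z) - 1, the integral is twice Cauchy's formula at z
  minus the mean value at 0. The factor \<open>- 2 * \<i>\<close> in the proof cancels the \<i> of
  the parametrization and doubles.\<close>

lemma has_integral_Schwarz_kernel:
  fixes G :: "complex \<Rightarrow> complex"
  assumes G: "continuous_on (cball 0 1) G" "G holomorphic_on ball 0 1"
    and z: "norm z < 1"
  shows "((\<lambda>\<theta>. G (cis \<theta>) * ((cis \<theta> + z) / (cis \<theta> - z))) has_integral
           2 * pi * (2 * G z - G 0)) {0..2 * pi}"
proof -
  have "((\<lambda>u. G u / (u - z)) has_contour_integral (2 * of_real pi * \<i> * G z)) (circlepath 0 1)"
    by (rule Cauchy_integral_circlepath) (use assms in auto)
  then have "((\<lambda>\<theta>. G (cis \<theta>) / (cis \<theta> - z) * \<i> * cis \<theta>) has_integral (2 * of_real pi * \<i> * G z)) {0..2 * pi}"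
    unfolding circlepath_def by (subst (asm) has_contour_integral_part_circlepath_iff) auto
  from has_integral_diff[OF has_integral_mult_left[OF this, of "- 2 * \<i>"] has_integral_circle_mean[OF G]]
  have "((\<lambda>\<theta>. G (cis \<theta>) / (cis \<theta> - z) * \<i> * cis \<theta> * (- 2 * \<i>) - G (cis \<theta>)) has_integral
           2 * pi * (2 * G z - G 0)) {0..2 * pi}"
    by (simp add: algebra_simps)
  moreover have "G (cis \<theta>) / (cis \<theta> - z) * \<i> * cis \<theta> * (- 2 * \<i>) - G (cis \<theta>) =
      G (cis \<theta>) * ((cis \<theta> + z) / (cis \<theta> - z))" for \<theta>
  proof -
    have "cis \<theta> - z \<noteq> 0" using z by (metis norm_cis less_irrefl right_minus_eq)
    then show ?thesis by (simp add: field_simps)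
  qed
  ultimately show ?thesis by simp
qed

lemma one_minus_mult_neq_0:
  fixes z w :: complex
  assumes "norm z < 1" "norm w \<le> 1"
  shows "1 - z * w \<noteq> 0"
proof
  assume "1 - z * w = 0"
  then have "norm (z * w) = 1" by (metis eq_iff_diff_eq_0 norm_one)
  moreover have "norm (z * w) < 1"
    using assms by (metis mult.right_neutral mult_left_mono norm_ge_zero norm_mult order_le_less_trans)
  ultimately show False by simp
qed

text \<open>Passes from the kernel in which \<open>psi_transform\<close> is written to the Schwarz
  kernel of Cauchy's formula; on the circle this replaces a point by its conjugate.\<close>

lemma Herglotz_kernel_reciprocal:
  fixes c s z :: complex
  assumes "c * s = 1"
  shows "(1 + z * s) / (1 - z * s) = (c + z) / (c - z)"
proof -
  have "c \<noteq> 0" using assms by auto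
  then have "(1 + z * s) / (1 - z * s) = (c * (1 + z * s)) / (c * (1 - z * s))" by simp
  moreover have "c * (1 + z * s) = c + z" "c * (1 - z * s) = c - z"
    using assms by (simp_all add: algebra_simps)
  ultimately show ?thesis by simp
qed

text \<open>Against the Schwarz kernel, \<open>G\<close> contributes \<open>2 G(z) - G(0)\<close>, while its conjugate only
  contributes the conjugate of \<open>G(0)\<close>, because the kernel is anti-analytic on the circle.\<close>

lemma Schwarz_integral_formula:
  fixes G :: "complex \<Rightarrow> complex"
  assumes G: "continuous_on (cball 0 1) G" "G holomorphic_on ball 0 1"
    and G0: "G 0 \<in> \<real>" and z: "norm z < 1"
  shows "((\<lambda>\<theta>. Re (G (cis \<theta>)) *\<^sub>R ((cis \<theta> + z) / (cis \<theta> - z))) has_integral 2 * pi * G z) {0..2 * pi}"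
proof -
  \<comment> \<open>\<open>H\<close> is holomorphic, and on the circle its conjugate is
    \<open>cnj (G w)\<close> times the Schwarz kernel, so the mean value property evaluates that
    integral.\<close>
  define H where "H = (\<lambda>w. G w * ((1 + cnj z * w) / (1 - cnj z * w)))"
  have nz: "1 - cnj z * w \<noteq> 0" if "norm w \<le> 1" for w
    using one_minus_mult_neq_0[of "cnj z" w] z that by simp
  have "((\<lambda>\<theta>. H (cis \<theta>)) has_integral 2 * pi * H 0) {0..2 * pi}"
    by (rule has_integral_circle_mean)
       (use nz G in \<open>auto simp: H_def intro!: continuous_intros holomorphic_intros\<close>)
  then have "((\<lambda>\<theta>. cnj (H (cis \<theta>))) has_integral cnj (2 * pi * H 0)) {0..2 * pi}"
    by (subst has_integral_cnj[symmetric]) (simp add: o_def)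
  moreover have "cnj (2 * pi * H 0) = 2 * pi * G 0"
    using G0 by (simp add: H_def Reals_cnj_iff)
  moreover have "cnj (H (cis \<theta>)) = cnj (G (cis \<theta>)) * ((cis \<theta> + z) / (cis \<theta> - z))" for \<theta>
    using Herglotz_kernel_reciprocal[of "cis \<theta>" "cnj (cis \<theta>)" z]
    by (simp add: H_def cis_cnj cis_mult flip: times_divide_eq_right)
  ultimately have "((\<lambda>\<theta>. cnj (G (cis \<theta>)) * ((cis \<theta> + z) / (cis \<theta> - z))) has_integral 2 * pi * G 0) {0..2 * pi}"
    by simp
  from has_integral_mult_left[OF has_integral_add[OF this has_integral_Schwarz_kernel[OF G z]], of "1/2"]
  have *: "((\<lambda>\<theta>. (cnj (G (cis \<theta>)) * ((cis \<theta> + z) / (cis \<theta> - z)) + G (cis \<theta>) * ((cis \<theta> + z) / (cis \<theta> - z))) * (1/2))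
      has_integral 2 * pi * G z) {0..2 * pi}"
    by (simp add: algebra_simps)
  have "(cnj g * k + g * k) * (1/2) = Re g *\<^sub>R k" for g k :: complex
    by (simp add: complex_eq_iff field_simps)
  with * show ?thesis by (simp only:)
qed

lemma continuous_on_Herglotz_kernel:
  fixes z :: complex
  assumes "norm z < 1"
  shows "continuous_on (cball 0 1) (\<lambda>s. (1 + z * s) / (1 - z * s))"
  using one_minus_mult_neq_0[OF assms] by (auto intro!: continuous_intros)

lemma Herglotz_kernel_bounded:
  fixes z s :: complex
  assumes "norm z < 1" "norm s \<le> 1"
  shows "norm ((1 + z * s) / (1 - z * s)) \<le> 2 / (1 - norm z)"
proof -
  have zs: "norm (z * s) \<le> norm z"
    using assms by (simp add: norm_mult mult_left_le)
  have "norm (1 + z * s) \<le> 2"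
    using norm_triangle_ineq[of 1 "z * s"] zs assms by simp
  moreover have "1 - norm z \<le> norm (1 - z * s)"
    using norm_triangle_ineq2[of 1 "z * s"] zs by simp
  ultimately show ?thesis
    using assms unfolding norm_divide by (intro frac_le) auto
qed

lemma distr_circle_prob:
  assumes N: "prob_space N" and f: "f \<in> N \<rightarrow>\<^sub>M restrict_space borel (sphere 0 1)"
  shows "distr N (restrict_space borel (sphere 0 1)) f \<in> circle_prob"
  using prob_space.prob_space_distr[OF N f] by (simp add: circle_prob_def)

text \<open>Harmonic measure in the angle variable. It lives on the line, over one period, because
  tightness and Helly's theorem concern real distributions.\<close>

definition circle_density :: "(complex \<Rightarrow> complex) \<Rightarrow> real measure" where
  "circle_density G = density lborel (\<lambda>\<theta>. ennreal (indicator {0..2 * pi} \<theta> * (Re (G (cis \<theta>)) / (2 * pi))))"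

lemma integral_circle_density:
  fixes k :: "real \<Rightarrow> complex"
  assumes G: "continuous_on (cball 0 1) G" "\<And>z. norm z = 1 \<Longrightarrow> Re (G z) \<ge> 0"
    and k: "continuous_on UNIV k"
    and I: "((\<lambda>\<theta>. Re (G (cis \<theta>)) *\<^sub>R k \<theta>) has_integral I) {0..2 * pi}"
  shows "integral\<^sup>L (circle_density G) k = I / (2 * pi)"
proof -
  have cont: "continuous_on A (\<lambda>\<theta>. G (cis \<theta>))" for A
    by (rule continuous_on_compose2[OF G(1)]) (auto intro!: continuous_intros)
  have [measurable]: "k \<in> borel_measurable borel" "(\<lambda>\<theta>. G (cis \<theta>)) \<in> borel_measurable borel"
    by (intro borel_measurable_continuous_onI k cont)+
  have "integral\<^sup>L (circle_density G) k =
      (\<integral>\<theta>. (indicator {0..2 * pi} \<theta> * (Re (G (cis \<theta>)) / (2 * pi))) *\<^sub>R k \<theta> \<partial>lborel)"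
    unfolding circle_density_def
    by (rule integral_density) (use G(2) in \<open>auto split: split_indicator\<close>)
  also have "\<dots> = (LINT \<theta> : {0..2 * pi} | lborel. (1 / (2 * pi)) *\<^sub>R Re (G (cis \<theta>)) *\<^sub>R k \<theta>)"
    unfolding set_lebesgue_integral_def by (intro Bochner_Integration.integral_cong) auto
  also have "\<dots> = integral {0..2 * pi} (\<lambda>\<theta>. (1 / (2 * pi)) *\<^sub>R Re (G (cis \<theta>)) *\<^sub>R k \<theta>)"
    by (rule set_borel_integral_eq_integral borel_integrable_atLeastAtMost')+
       (intro continuous_intros cont continuous_on_subset[OF k], auto)
  also have "\<dots> = (1 / (2 * pi)) *\<^sub>R I"
    by (intro integral_unique has_integral_scaleR_left I has_integral_cmul)
  finally show ?thesis by (simp add: scaleR_conv_of_real)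
qed

text \<open>The total mass is the mean value Re (G 0) = 1. The half-open interval has the shape that
  \<open>tight\<close> asks for; -1 and 7 are just numbers on either side of 0 and 2 pi.\<close>

lemma circle_density_prob:
  assumes G: "continuous_on (cball 0 1) G" "G holomorphic_on ball 0 1"
    and pos: "\<And>z. norm z = 1 \<Longrightarrow> Re (G z) \<ge> 0" and G0: "G 0 = 1"
  shows "real_distribution (circle_density G)"
    "measure (circle_density G) {-1<..7} = 1"
proof -
  have cont: "continuous_on A (\<lambda>\<theta>. G (cis \<theta>))" for A
    by (rule continuous_on_compose2[OF G(1)]) (auto intro!: continuous_intros)
  have [measurable]: "(\<lambda>\<theta>. G (cis \<theta>)) \<in> borel_measurable borel"
    by (intro borel_measurable_continuous_onI cont)
  have "((\<lambda>\<theta>. Re (G (cis \<theta>))) has_integral Re (2 * pi * G 0)) {0..2 * pi}"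
    using has_integral_linear[OF has_integral_circle_mean[OF G] bounded_linear_Re] by (simp add: o_def)
  then have "((\<lambda>\<theta>. 1 / (2 * pi) * Re (G (cis \<theta>))) has_integral 1 / (2 * pi) * Re (2 * pi * G 0)) {0..2 * pi}"
    by (rule has_integral_mult_right)
  then have "((\<lambda>\<theta>. if \<theta> \<in> {0..2 * pi} then 1 / (2 * pi) * Re (G (cis \<theta>)) else 0) has_integral 1) UNIV"
    unfolding has_integral_restrict_UNIV by (simp add: G0)
  also have "(\<lambda>\<theta>. if \<theta> \<in> {0..2 * pi} then 1 / (2 * pi) * Re (G (cis \<theta>)) else 0) =
      (\<lambda>\<theta>. indicator {0..2 * pi} \<theta> * (Re (G (cis \<theta>)) / (2 * pi)))"
    by (auto split: split_indicator)
  finally have one: "(\<integral>\<^sup>+\<theta>. ennreal (indicator {0..2 * pi} \<theta> * (Re (G (cis \<theta>)) / (2 * pi))) \<partial>lborel) = 1"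
    by (subst nn_integral_has_integral_lborel) (use pos in \<open>auto split: split_indicator\<close>)
  then have "prob_space (circle_density G)"
    by (intro prob_spaceI) (simp add: circle_density_def emeasure_density)
  then show "real_distribution (circle_density G)"
    by (simp add: real_distribution_def real_distribution_axioms_def circle_density_def)
  have "2 * pi < 7" using pi_approx by simp
  then have "(\<lambda>\<theta>. ennreal (indicator {0..2 * pi} \<theta> * (Re (G (cis \<theta>)) / (2 * pi))) * indicator {-1<..7} \<theta>) =
      (\<lambda>\<theta>. ennreal (indicator {0..2 * pi} \<theta> * (Re (G (cis \<theta>)) / (2 * pi))))"
    by (auto split: split_indicator)
  then have "emeasure (circle_density G) {-1<..7} = 1"
    unfolding circle_density_def using one by (subst emeasure_density) simp_all
  then show "measure (circle_density G) {-1<..7} = 1"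
    by (simp add: measure_def)
qed

text \<open>Helly's theorem gives a weak limit of the harmonic measures of the radii \<open>r < 1\<close>, lifted
  from the circle to the real line.\<close>

theorem Herglotz_representation:
  assumes F: "F holomorphic_on ball 0 1" "\<And>z. norm z < 1 \<Longrightarrow> Re (F z) \<ge> 0" "F 0 = 1"
  obtains M where "M \<in> circle_prob"
    "\<And>z. norm z < 1 \<Longrightarrow> (\<integral>s. (1 + z * s) / (1 - z * s) \<partial>M) = F z"
proof -
  define r :: "nat \<Rightarrow> real" where "r = (\<lambda>n. real n / (real n + 1))"
  have r: "0 \<le> r n" "r n < 1" for n by (auto simp: r_def)
  have "r \<longlonglongrightarrow> 1" unfolding r_def by real_asymp
  \<comment> \<open>Unlike \<open>F\<close>, these dilates are continuous on the closed disc, and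
    they tend to \<open>F\<close> pointwise on the open disc.\<close>
  define G where "G = (\<lambda>n z. F (of_real (r n) * z))"
  have rz: "norm (of_real (r n) * z) < 1" if "norm z \<le> 1" for n and z :: complex
    using r[of n] that mult_left_le[of "norm z" "r n"] by (simp add: norm_mult)
  have contG: "continuous_on (cball 0 1) (G n)" for n
    unfolding G_def using rz
    by (intro continuous_on_compose2[OF holomorphic_on_imp_continuous_on[OF F(1)]])
       (auto intro!: continuous_intros)
  have holG: "G n holomorphic_on ball 0 1" for n
    unfolding G_def using rz
    by (intro holomorphic_on_compose_gen[OF _ F(1), unfolded o_def]) (auto intro!: holomorphic_intros)
  have posG: "Re (G n z) \<ge> 0" if "norm z = 1" for n z
    unfolding G_def using that by (intro F rz) auto
  have G0: "G n 0 = 1" for n by (simp add: G_def F)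
  note dens = circle_density_prob[OF contG holG posG G0]
  have "tight (\<lambda>n. circle_density (G n))"
    unfolding tight_def using dens by (intro conjI allI impI exI[of _ "-1"] exI[of _ "7"]) auto
  from tight_imp_convergent_subsubsequence[OF this strict_mono_id]
  obtain q N where q: "strict_mono q" and N: "real_distribution N"
    and wc: "weak_conv_m (\<lambda>n. circle_density (G (q n))) N"
    by (auto simp: o_def)
  interpret N: real_distribution N by fact
  \<comment> \<open>The minus sign produces the reciprocal of the boundary point, as
    \<open>Herglotz_kernel_reciprocal\<close> requires.\<close>
  define e :: "real \<Rightarrow> complex" where "e = (\<lambda>\<theta>. cis (- \<theta>))"
  have conte: "continuous_on A e" for A unfolding e_def by (intro continuous_intros)
  have e[measurable]: "e \<in> N \<rightarrow>\<^sub>M restrict_space borel (sphere 0 1)"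
    by (intro measurable_restrict_space2)
       (use borel_measurable_continuous_onI[OF conte] in \<open>auto simp: e_def measurable_def\<close>)
  show thesis
  proof
    show "distr N (restrict_space borel (sphere 0 1)) e \<in> circle_prob"
      by (rule distr_circle_prob) (auto simp: N.prob_space_axioms)
    fix z :: complex assume z: "norm z < 1"
    define k where "k = (\<lambda>s. (1 + z * s) / (1 - z * s))"
    have contk: "continuous_on UNIV (\<lambda>\<theta>. k (e \<theta>))"
      unfolding k_def
      by (rule continuous_on_compose2[OF continuous_on_Herglotz_kernel[OF z] conte]) (auto simp: e_def)
    have ke: "k (e \<theta>) = (cis \<theta> + z) / (cis \<theta> - z)" for \<theta>
      unfolding k_def e_def by (rule Herglotz_kernel_reciprocal) (simp add: cis_mult)
    have int: "integral\<^sup>L (circle_density (G n)) (\<lambda>\<theta>. k (e \<theta>)) = F (of_real (r n) * z)" for n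
    proof -
      have "integral\<^sup>L (circle_density (G n)) (\<lambda>\<theta>. k (e \<theta>)) = 2 * pi * G n z / (2 * pi)"
        using Schwarz_integral_formula[OF contG holG _ z] G0 posG
        by (intro integral_circle_density contG contk) (auto simp: ke)
      then show ?thesis by (simp add: G_def)
    qed
    have "(\<lambda>n. integral\<^sup>L (circle_density (G (q n))) (\<lambda>\<theta>. k (e \<theta>))) \<longlonglongrightarrow> integral\<^sup>L N (\<lambda>\<theta>. k (e \<theta>))"
    proof (rule weak_conv_imp_integral_bdd_continuous_conv[OF _ N wc])
      show "real_distribution (circle_density (G (q n)))" for n by (rule dens(1))
      show "isCont (\<lambda>\<theta>. k (e \<theta>)) x" for x
        using contk by (simp add: continuous_on_eq_continuous_at)
      show "norm (k (e x)) \<le> 2 / (1 - norm z)" for x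
        unfolding k_def using z by (intro Herglotz_kernel_bounded) (auto simp: e_def)
    qed
    moreover have "(\<lambda>n. F (of_real (r (q n)) * z)) \<longlonglongrightarrow> F z"
    proof -
      have "isCont F z"
        using F(1) z by (auto simp: holomorphic_on_imp_continuous_on continuous_on_eq_continuous_at
            dest!: holomorphic_on_imp_continuous_on)
      moreover have "(\<lambda>n. of_real (r (q n)) * z) \<longlonglongrightarrow> of_real 1 * z"
        using LIMSEQ_subseq_LIMSEQ[OF \<open>r \<longlonglongrightarrow> 1\<close> q] by (intro tendsto_intros) (simp add: o_def)
      ultimately show ?thesis by (auto intro: isCont_tendsto_compose)
    qed
    ultimately have "integral\<^sup>L N (\<lambda>\<theta>. k (e \<theta>)) = F z"
      unfolding int by (rule LIMSEQ_unique)
    moreover have "k \<in> borel_measurable (restrict_space borel (sphere 0 1))"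
      unfolding k_def
      by (intro borel_measurable_continuous_on_restrict continuous_on_subset[OF continuous_on_Herglotz_kernel[OF z]]) auto
    ultimately show "(\<integral>s. (1 + z * s) / (1 - z * s) \<partial>distr N (restrict_space borel (sphere 0 1)) e) = F z"
      using integral_distr[OF e, of k] by (simp add: k_def)
  qed
qed

section \<open>Transforms of measures on the circle\<close>

lemma circle_prob_prob_space: "M \<in> circle_prob \<Longrightarrow> prob_space M"
  by (simp add: circle_prob_def)

lemma circle_prob_sets: "M \<in> circle_prob \<Longrightarrow> sets M = sets (restrict_space borel (sphere 0 1))"
  by (simp add: circle_prob_def)

lemma circle_prob_space: "M \<in> circle_prob \<Longrightarrow> space M = sphere 0 1"
  using sets_eq_imp_space_eq[OF circle_prob_sets] by (simp add: space_restrict_space)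

lemma circle_prob_measurable:
  assumes "M \<in> circle_prob" "continuous_on (sphere 0 1) f"
  shows "f \<in> borel_measurable M"
  using borel_measurable_continuous_on_restrict[OF assms(2)]
  by (simp add: measurable_cong_sets[OF circle_prob_sets[OF assms(1)] refl])

lemma circle_prob_integrable:
  fixes f :: "complex \<Rightarrow> 'b :: {banach, second_countable_topology}"
  assumes M: "M \<in> circle_prob" and f: "continuous_on (sphere 0 1) f"
  shows "integrable M f"
proof -
  interpret prob_space M by (rule circle_prob_prob_space[OF M])
  have "bounded (f ` sphere 0 1)"
    by (intro compact_imp_bounded compact_continuous_image f) simp
  then obtain B where "\<forall>s\<in>sphere 0 1. norm (f s) \<le> B"
    unfolding bounded_iff by blast
  then show ?thesis
    by (intro integrable_const_bound[of _ B] circle_prob_measurable[OF M f])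
       (auto intro!: AE_I2 simp: circle_prob_space[OF M])
qed

section \<open>Moment series of psi, and the behaviour of eta at the origin\<close>

lemma psi_sums:
  assumes M: "M \<in> circle_prob" and z: "norm z < 1"
  shows "(\<lambda>n. (\<integral>s. s ^ n \<partial>M) * z ^ n) sums (1 + psi_transform M z)"
proof -
  interpret prob_space M by (rule circle_prob_prob_space[OF M])
  have nz: "1 - z * s \<noteq> 0" if "norm s = 1" for s
    using one_minus_mult_neq_0[OF z] that by simp
  have sum: "(\<lambda>n. (z * s) ^ n) sums (1 / (1 - z * s))" if "s \<in> space M" for s
    using that z by (intro geometric_sums) (simp add: circle_prob_space[OF M] norm_mult)
  have int: "integrable M (\<lambda>s. (z * s) ^ n)" for n
    by (intro circle_prob_integrable[OF M] continuous_intros)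
  have "norm ((z * s) ^ n) = norm z ^ n" if "s \<in> space M" for s n
    using that by (simp add: circle_prob_space[OF M] norm_mult norm_power)
  then have norm: "AE s in M. norm ((z * s) ^ n) = norm z ^ n" for n by auto
  \<comment> \<open>|z s| = |z| < 1 on the circle makes the norms summable, so the geometric series
    for 1/(1 - z s) may be integrated termwise. Its term of order 0 accounts for the summand
    1.\<close>
  have "(\<integral>s. norm ((z * s) ^ n) \<partial>M) = (\<integral>s. norm z ^ n \<partial>M)" for n
    by (rule integral_cong_AE) (use norm int in \<open>auto intro: borel_measurable_integrable\<close>)
  then have "(\<lambda>n. \<integral>s. norm ((z * s) ^ n) \<partial>M) = (\<lambda>n. norm z ^ n)"
    by (simp add: prob_space)
  then have "(\<lambda>n. \<integral>s. (z * s) ^ n \<partial>M) sums (\<integral>s. (\<Sum>n. (z * s) ^ n) \<partial>M)"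
    using z int by (intro sums_integral) (auto intro!: AE_I2 summable_geometric
        simp: circle_prob_space[OF M] norm_mult norm_power summable_geometric)
  also have "(\<lambda>n. \<integral>s. (z * s) ^ n \<partial>M) = (\<lambda>n. (\<integral>s. s ^ n \<partial>M) * z ^ n)"
    by (simp add: power_mult_distrib mult.commute)
  also have "(\<integral>s. (\<Sum>n. (z * s) ^ n) \<partial>M) = (\<integral>s. 1 + z * s / (1 - z * s) \<partial>M)"
  proof (rule Bochner_Integration.integral_cong[OF refl])
    fix s assume s: "s \<in> space M"
    then have "1 - z * s \<noteq> 0" using nz by (simp add: circle_prob_space[OF M])
    then show "(\<Sum>n. (z * s) ^ n) = 1 + z * s / (1 - z * s)"
      using sums_unique[OF sum[OF s]] by (simp add: field_simps)
  qed
  also have "\<dots> = 1 + psi_transform M z"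
    unfolding psi_transform_def
    by (subst Bochner_Integration.integral_add)
       (use nz in \<open>auto simp: prob_space intro!: circle_prob_integrable[OF M] continuous_intros\<close>)
  finally show ?thesis .
qed

lemma psi_has_fps_expansion:
  assumes M: "M \<in> circle_prob"
  shows "(\<lambda>z. 1 + psi_transform M z) has_fps_expansion Abs_fps (\<lambda>n. \<integral>s. s ^ n \<partial>M)"
proof (rule has_fps_expansionI)
  have "eventually (\<lambda>z. z \<in> ball 0 1) (nhds (0 :: complex))"
    by (intro eventually_nhds_in_open) auto
  then show "eventually (\<lambda>z. (\<lambda>n. Abs_fps (\<lambda>n. \<integral>s. s ^ n \<partial>M) $ n * z ^ n) sums (1 + psi_transform M z)) (nhds 0)"
    by eventually_elim (use psi_sums[OF M] in simp)
qed

lemma psi_transform_0: "psi_transform M 0 = 0"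
  by (simp add: psi_transform_def)

lemma eta_transform_0: "eta_transform M 0 = 0"
  by (simp add: eta_transform_def psi_transform_0)

lemma psi_holomorphic:
  assumes M: "M \<in> circle_prob"
  shows "psi_transform M holomorphic_on ball 0 1"
proof -
  have "(\<lambda>z. 1 + psi_transform M z) holomorphic_on ball 0 1"
    by (rule power_series_holomorphic[where a = "\<lambda>n. \<integral>s. s ^ n \<partial>M"]) (use psi_sums[OF M] in simp)
  from holomorphic_on_diff[OF this holomorphic_on_const[of 1]] show ?thesis by simp
qed

lemma psi_deriv_0:
  assumes M: "M \<in> circle_prob"
  shows "(psi_transform M has_field_derivative first_moment M) (at 0)"
proof -
  have "deriv (\<lambda>z. 1 + psi_transform M z) 0 = first_moment M"
    using fps_nth_fps_expansion[OF psi_has_fps_expansion[OF M], of 1] by (simp add: first_moment_def)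
  moreover have "((\<lambda>z. 1 + psi_transform M z) has_field_derivative deriv (\<lambda>z. 1 + psi_transform M z) 0) (at 0)"
    using psi_holomorphic[OF M] by (intro holomorphic_derivI[of _ "ball 0 1"] holomorphic_intros) auto
  ultimately have "((\<lambda>z. 1 + psi_transform M z) has_field_derivative first_moment M) (at 0)" by simp
  from DERIV_diff[OF this DERIV_const[of 1]] show ?thesis by simp
qed

lemma one_plus_psi_nonzero:
  assumes M: "M \<in> circle_prob"
  obtains r where "0 < r" "r \<le> 1" "\<And>z. z \<in> ball 0 r \<Longrightarrow> 1 + psi_transform M z \<noteq> 0"
proof -
  have "isCont (psi_transform M) 0" using psi_deriv_0[OF M] by (rule DERIV_isCont)
  then have "isCont (\<lambda>z. 1 + psi_transform M z) 0" by simp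
  then obtain e where "e > 0" "\<forall>y. dist 0 y < e \<longrightarrow> 1 + psi_transform M y \<noteq> 0"
    using continuous_at_avoid[of 0 "\<lambda>z. 1 + psi_transform M z" 0] by (auto simp: psi_transform_0)
  then show thesis using that[of "min e 1"] by auto
qed

lemma eta_holomorphic:
  assumes M: "M \<in> circle_prob" and r: "r \<le> 1" "\<And>z. z \<in> ball 0 r \<Longrightarrow> 1 + psi_transform M z \<noteq> 0"
  shows "eta_transform M holomorphic_on ball 0 r"
proof -
  have "psi_transform M holomorphic_on ball 0 r"
    by (rule holomorphic_on_subset[OF psi_holomorphic[OF M]]) (use r in auto)
  then show ?thesis unfolding eta_transform_def by (intro holomorphic_intros r(2))
qed

lemma eta_deriv_0:
  assumes M: "M \<in> circle_prob"
  shows "(eta_transform M has_field_derivative first_moment M) (at 0)"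
  unfolding eta_transform_def
  using psi_deriv_0[OF M] by (auto intro!: derivative_eq_intros simp: psi_transform_0)

section \<open>Moments determine a measure on the circle\<close>

text \<open>Trigonometric polynomials; they stand in for all continuous functions by the
  Stone--Weierstrass theorem.\<close>

inductive trig_poly :: "(complex \<Rightarrow> complex) \<Rightarrow> bool" where
  monom: "trig_poly (\<lambda>s. c * (s ^ k * cnj s ^ l))"
| add: "trig_poly f \<Longrightarrow> trig_poly g \<Longrightarrow> trig_poly (\<lambda>s. f s + g s)"

lemma trig_poly_mult:
  assumes "trig_poly f" "trig_poly g"
  shows "trig_poly (\<lambda>s. f s * g s)"
  using assms
proof (induction f)
  case (monom c k l)
  then show ?case
  proof (induction g)
    case (monom d m n)
    have "(\<lambda>s. c * (s ^ k * cnj s ^ l) * (d * (s ^ m * cnj s ^ n))) =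
        (\<lambda>s. (c * d) * (s ^ (k + m) * cnj s ^ (l + n)))"
      by (simp add: power_add mult_ac)
    then show ?case using trig_poly.monom by metis
  next
    case (add f g)
    then show ?case by (auto simp: distrib_left intro: trig_poly.add)
  qed
next
  case (add f g')
  then show ?case by (auto simp: distrib_right intro: trig_poly.add)
qed

lemma trig_poly_real_polynomial:
  assumes "real_polynomial_function p"
  shows "trig_poly (\<lambda>s. of_real (p s))"
  using assms
proof induction
  case (linear f)
  interpret bounded_linear f by fact
  define a b where "a = f 1" and "b = f \<i>"
  \<comment> \<open>A real-linear f is a Re s + b Im s; the coefficients come from Re s = (s + cnj
    s)/2 and Im s = (s - cnj s)/(2 \<i>).\<close>
  have "(\<lambda>s. of_real (f s)) =
      (\<lambda>s. (of_real a - \<i> * of_real b) / 2 * (s ^ 1 * cnj s ^ 0) +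
           (of_real a + \<i> * of_real b) / 2 * (s ^ 0 * cnj s ^ 1))"
  proof
    fix s
    have "f s = f (Re s *\<^sub>R 1 + Im s *\<^sub>R \<i>)"
      by (rule arg_cong[of _ _ f]) (simp add: complex_eq_iff)
    also have "\<dots> = Re s * a + Im s * b" by (simp only: add scale) (simp add: a_def b_def)
    finally show "of_real (f s) = (of_real a - \<i> * of_real b) / 2 * (s ^ 1 * cnj s ^ 0) +
           (of_real a + \<i> * of_real b) / 2 * (s ^ 0 * cnj s ^ 1)"
      by (simp add: complex_eq_iff field_simps)
  qed
  then show ?case by (simp only: trig_poly.intros)
next
  case (const c)
  show ?case using trig_poly.monom[of "of_real c" 0 0] by simp
qed (auto intro: trig_poly.add trig_poly_mult)

text \<open>On the circle \<open>cnj s\<close> is the inverse of \<open>s\<close>. Hence the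
  integral of every monomial is a moment or the conjugate of one, and moments of nonnegative order
  suffice.\<close>

lemma power_cnj_power_circle:
  assumes "norm s = 1"
  shows "s ^ k * cnj s ^ l = (if l \<le> k then s ^ (k - l) else cnj (s ^ (l - k)))"
proof -
  have 1: "s ^ n * cnj s ^ n = 1" for n
    using assms complex_norm_square[of s] by (simp flip: power_mult_distrib)
  show ?thesis
  proof (cases "l \<le> k")
    case True
    then obtain d where "k = l + d" by (auto simp: le_iff_add)
    with 1[of l] show ?thesis by (simp add: power_add mult_ac)
  next
    case False
    then obtain d where "l = k + d" by (auto simp: not_le less_iff_Suc_add)
    with 1[of k] show ?thesis by (simp add: power_add mult_ac)
  qed
qed

lemma circle_prob_integral_continuous_eq:
  fixes f :: "complex \<Rightarrow> real"
  assumes M: "M \<in> circle_prob" and N: "N \<in> circle_prob"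
    and mom: "\<And>n. (\<integral>s. s ^ n \<partial>M) = (\<integral>s. s ^ n \<partial>N)"
    and f: "continuous_on (sphere 0 1) f"
  shows "integral\<^sup>L M f = integral\<^sup>L N f"
proof -
  interpret M: prob_space M by (rule circle_prob_prob_space[OF M])
  interpret N: prob_space N by (rule circle_prob_prob_space[OF N])
  have mono: "(\<integral>s. s ^ k * cnj s ^ l \<partial>R) =
      (if l \<le> k then (\<integral>s. s ^ (k - l) \<partial>R) else cnj (\<integral>s. s ^ (l - k) \<partial>R))"
    if R: "R \<in> circle_prob" for R k l
  proof -
    have "(\<integral>s. s ^ k * cnj s ^ l \<partial>R) = (\<integral>s. (if l \<le> k then s ^ (k - l) else cnj (s ^ (l - k))) \<partial>R)"
      by (intro Bochner_Integration.integral_cong refl power_cnj_power_circle)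
         (simp add: circle_prob_space[OF R])
    then show ?thesis by (simp del: complex_cnj_power)
  qed
  \<comment> \<open>Continuity is carried through the induction to make both summands integrable in
    the case of a sum.\<close>
  have trig: "continuous_on UNIV h \<and> integral\<^sup>L M h = integral\<^sup>L N h" if "trig_poly h" for h
    using that
  proof induction
    case (monom c k l)
    have "(\<integral>s. s ^ k * cnj s ^ l \<partial>M) = (\<integral>s. s ^ k * cnj s ^ l \<partial>N)"
      by (simp only: mono[OF M] mono[OF N] mom)
    then show ?case by (auto intro!: continuous_intros)
  next
    case (add f g)
    then have "integrable R f" "integrable R g" if "R \<in> circle_prob" for R
      by (auto intro: circle_prob_integrable[OF that] continuous_on_subset)
    with add M N show ?case by (auto intro!: continuous_intros)
  qed
  have "\<bar>integral\<^sup>L M f - integral\<^sup>L N f\<bar> \<le> e" if "e > 0" for e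
  proof -
    obtain p where p: "polynomial_function p" "\<And>s. s \<in> sphere 0 1 \<Longrightarrow> norm (f s - p s) < e / 2"
      using Stone_Weierstrass_polynomial_function[OF compact_sphere f, of "e / 2"] \<open>e > 0\<close> by auto
    then have "trig_poly (\<lambda>s. of_real (p s))"
      by (intro trig_poly_real_polynomial) (simp add: real_polynomial_function_eq)
    from trig[OF this] have pe: "integral\<^sup>L M p = integral\<^sup>L N p" by simp
    have cp: "continuous_on (sphere 0 1) p"
      using p(1) by (rule continuous_on_polymonial_function)
    have "\<bar>integral\<^sup>L R f - integral\<^sup>L R p\<bar> \<le> e / 2" if R: "R \<in> circle_prob" for R
    proof -
      interpret prob_space R by (rule circle_prob_prob_space[OF R])
      have "integral\<^sup>L R f - integral\<^sup>L R p = (\<integral>s. f s - p s \<partial>R)"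
        by (intro Bochner_Integration.integral_diff[symmetric] circle_prob_integrable[OF R] f cp)
      also have "\<bar>\<dots>\<bar> \<le> (\<integral>s. e / 2 \<partial>R)"
        unfolding real_norm_def[symmetric]
        by (rule Bochner_Integration.integral_norm_bound_integral)
           (use p in \<open>auto intro!: circle_prob_integrable[OF R] continuous_intros f cp simp: circle_prob_space[OF R] less_imp_le\<close>)
      finally show ?thesis by (simp add: prob_space)
    qed
    from this[OF M] this[OF N] pe show ?thesis by linarith
  qed
  then show ?thesis by (metis abs_le_zero_iff field_le_epsilon add_0 eq_iff_diff_eq_0)
qed

text \<open>Indicators of closed sets are pointwise limits of continuous functions, and closed sets
  form an intersection-stable generator of the Borel sets. The measures are pushed forward to the
  plane so that this generator applies directly.\<close>

lemma circle_prob_eqI: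
  assumes M: "M \<in> circle_prob" and N: "N \<in> circle_prob"
    and mom: "\<And>n. (\<integral>s. s ^ n \<partial>M) = (\<integral>s. s ^ n \<partial>N)"
  shows "M = N"
proof -
  have id: "(\<lambda>s. s) \<in> R \<rightarrow>\<^sub>M borel" if "R \<in> circle_prob" for R
    by (intro circle_prob_measurable[OF that] continuous_intros)
  have closed_eq: "emeasure (distr M borel (\<lambda>s. s)) C = emeasure (distr N borel (\<lambda>s. s)) C"
    if C: "closed C" "C \<noteq> {}" for C
  proof -
    \<comment> \<open>1 on \<open>C\<close> and 0 from distance 1/n on. As
      \<open>infdist s {}\<close> is 0 by convention, the empty set is treated separately
      below.\<close>
    define f where "f = (\<lambda>n s. max 0 (1 - real n * infdist s C))"
    have cont: "continuous_on A (f n)" for n A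
      unfolding f_def by (intro continuous_intros)
    have lim: "(\<lambda>n. f n s) \<longlonglongrightarrow> indicator C s" for s
    proof (cases "s \<in> C")
      case False
      then have pos: "infdist s C > 0" using C by (simp add: infdist_pos_not_in_closed)
      have "eventually (\<lambda>n. 1 / infdist s C < real n) sequentially"
        using filterlim_real_sequentially by (simp add: filterlim_at_top_dense)
      then have "eventually (\<lambda>n. f n s = 0) sequentially"
        by eventually_elim (use pos in \<open>simp add: f_def field_simps\<close>)
      with False show ?thesis by (simp add: tendsto_eventually)
    qed (simp add: f_def)
    have conv: "(\<lambda>n. integral\<^sup>L R (f n)) \<longlonglongrightarrow> measure (distr R borel (\<lambda>s. s)) C"
      if R: "R \<in> circle_prob" for R
    proof -
      interpret prob_space R by (rule circle_prob_prob_space[OF R])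
      have [measurable]: "(\<lambda>s. s) \<in> R \<rightarrow>\<^sub>M borel" using R by (rule id)
      have [measurable]: "C \<in> sets borel" using C by simp
      have "indicator C \<in> borel_measurable (borel :: complex measure)" by simp
      from measurable_compose[OF id[OF R] this]
      have "(\<lambda>n. integral\<^sup>L R (f n)) \<longlonglongrightarrow> (\<integral>s. (indicator C s :: real) \<partial>R)"
        by (intro integral_dominated_convergence[where w = "\<lambda>_. 1"])
           (auto simp: lim circle_prob_measurable[OF R cont], auto simp: f_def infdist_nonneg)
      also have "(\<integral>s. (indicator C s :: real) \<partial>R) = (\<integral>s. (indicator C s :: real) \<partial>distr R borel (\<lambda>s. s))"
        using integral_distr[OF id[OF R], of "indicator C :: complex \<Rightarrow> real"] by simp
      finally show ?thesis by simp
    qed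
    have "integral\<^sup>L M (f n) = integral\<^sup>L N (f n)" for n
      by (intro circle_prob_integral_continuous_eq M N mom cont)
    then have "measure (distr M borel (\<lambda>s. s)) C = measure (distr N borel (\<lambda>s. s)) C"
      using LIMSEQ_unique[OF conv[OF M]] conv[OF N] by simp
    then show ?thesis
      using prob_space.prob_space_distr[OF circle_prob_prob_space[OF M] id[OF M]]
        prob_space.prob_space_distr[OF circle_prob_prob_space[OF N] id[OF N]]
      by (simp add: prob_space_def finite_measure.emeasure_eq_measure)
  qed
  have eq: "distr M borel (\<lambda>s. s) = distr N borel (\<lambda>s. s)"
  proof (rule measure_eqI_generator_eq[where E = "Collect closed" and \<Omega> = UNIV and A = "\<lambda>_. UNIV"])
    show "Int_stable (Collect (closed :: complex set \<Rightarrow> bool))" by (auto simp: Int_stable_def)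
    show "emeasure (distr M borel (\<lambda>s. s)) X = emeasure (distr N borel (\<lambda>s. s)) X" if "X \<in> Collect closed" for X
      using closed_eq that by (cases "X = {}") auto
    show "emeasure (distr M borel (\<lambda>s. s)) UNIV \<noteq> \<infinity>"
      using prob_space.prob_space_distr[OF circle_prob_prob_space[OF M] id[OF M]]
      by (simp add: prob_space_def finite_measure.emeasure_finite)
  qed (auto simp: borel_eq_closed)
  show ?thesis
  proof (rule measure_eqI)
    show "sets M = sets N" using M N by (simp add: circle_prob_sets)
    fix A assume A: "A \<in> sets M"
    then have "A \<subseteq> sphere 0 1" "A \<in> sets borel"
      by (auto simp: circle_prob_sets[OF M] sets_restrict_space_iff)
    then have "emeasure R A = emeasure (distr R borel (\<lambda>s. s)) A" if "R \<in> circle_prob" for R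
      using circle_prob_space[OF that] by (simp add: emeasure_distr[OF id[OF that]] Int_absorb2)
    with eq M N show "emeasure M A = emeasure N A" by simp
  qed
qed

section \<open>The eta-transform: uniqueness, local inverse, realization\<close>

lemma circle_prob_eqI_eta:
  assumes M: "M \<in> circle_prob" and N: "N \<in> circle_prob"
    and eq: "\<forall>\<^sub>F z in nhds 0. eta_transform M z = eta_transform N z"
  shows "M = N"
proof -
  have nz: "\<forall>\<^sub>F z in nhds 0. 1 + psi_transform R z \<noteq> 0" if R: "R \<in> circle_prob" for R
  proof -
    obtain r where "0 < r" "\<And>z. z \<in> ball 0 r \<Longrightarrow> 1 + psi_transform R z \<noteq> 0"
      using one_plus_psi_nonzero[OF R] by metis
    then show ?thesis unfolding eventually_nhds by (intro exI[of _ "ball 0 r"]) auto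
  qed
  \<comment> \<open>Recovers the moment generating function from eta, so that the moments can be
    compared as power series coefficients.\<close>
  have *: "1 + psi_transform R z = inverse (1 - eta_transform R z)" if "1 + psi_transform R z \<noteq> 0" for R z
    using that by (simp add: eta_transform_def field_simps)
  have "\<forall>\<^sub>F z in nhds 0. 1 + psi_transform M z = 1 + psi_transform N z"
    using eq nz[OF M] nz[OF N] by eventually_elim (metis *)
  then have "(\<lambda>z. 1 + psi_transform M z) has_fps_expansion Abs_fps (\<lambda>n. \<integral>s. s ^ n \<partial>N)"
    using psi_has_fps_expansion[OF N] has_fps_expansion_cong[OF _ refl] by metis
  then have "Abs_fps (\<lambda>n. \<integral>s. s ^ n \<partial>M) = Abs_fps (\<lambda>n. \<integral>s. s ^ n \<partial>N)"
    using psi_has_fps_expansion[OF M] fps_expansion_unique_complex by blast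
  then have "(\<integral>s. s ^ n \<partial>M) = (\<integral>s. s ^ n \<partial>N)" for n by (simp add: fps_eq_iff)
  then show ?thesis by (rule circle_prob_eqI[OF M N])
qed

text \<open>\<open>eta_inverse\<close> is a choice, so its defining property holds once a witness is
  found: the nonzero derivative makes eta injective near 0, and its inverse is holomorphic on the
  open image.\<close>

lemma eta_inverse_right_inverse:
  assumes M: "M \<in> circle_prob" and fm: "first_moment M \<noteq> 0"
  shows "\<forall>\<^sub>F z in nhds 0. eta_inverse M z \<in> ball 0 1 \<and> eta_transform M (eta_inverse M z) = z"
proof -
  obtain r where r: "0 < r" "r \<le> 1" "\<And>z. z \<in> ball 0 r \<Longrightarrow> 1 + psi_transform M z \<noteq> 0"
    using one_plus_psi_nonzero[OF M] by metis
  have hol: "eta_transform M holomorphic_on ball 0 r" by (rule eta_holomorphic[OF M r(2,3)])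
  have "deriv (eta_transform M) 0 \<noteq> 0"
    using DERIV_imp_deriv[OF eta_deriv_0[OF M]] fm by simp
  then obtain q where q: "q > 0" "ball (0 :: complex) q \<subseteq> ball 0 r" "inj_on (eta_transform M) (ball 0 q)"
  proof (rule has_complex_derivative_locally_injective[OF hol _ open_ball, rotated])
    show "0 \<in> ball 0 r" using r(1) by simp
  qed (rule that)
  have holq: "eta_transform M holomorphic_on ball 0 q" using hol q(2) by (rule holomorphic_on_subset)
  obtain g where g: "g holomorphic_on eta_transform M ` ball 0 q"
      "\<And>z. z \<in> ball 0 q \<Longrightarrow> g (eta_transform M z) = z"
    using holomorphic_has_inverse[OF holq open_ball q(3)] by metis
  have "open (eta_transform M ` ball 0 q)" by (rule open_mapping_thm3[OF holq open_ball q(3)])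
  moreover have "0 \<in> eta_transform M ` ball 0 q"
    using q(1) eta_transform_0 by (metis centre_in_ball image_eqI)
  ultimately obtain p where p: "p > 0" "ball 0 p \<subseteq> eta_transform M ` ball 0 q"
    by (meson open_contains_ball)
  have "\<forall>z\<in>ball 0 p. g z \<in> ball 0 1 \<and> eta_transform M (g z) = z"
    using p(2) g(2) q(2) r(2) by fastforce
  moreover have "g holomorphic_on ball 0 p" using g(1) p(2) by (rule holomorphic_on_subset)
  moreover have "g 0 = 0" using g(2)[of 0] q(1) by (simp add: eta_transform_0)
  ultimately have "\<exists>g. g 0 = 0 \<and> (\<exists>r>0. g holomorphic_on ball 0 r \<and>
     (\<forall>z \<in> ball 0 r. g z \<in> ball 0 1 \<and> eta_transform M (g z) = z))"
    using p(1) by blast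
  from someI_ex[OF this, folded eta_inverse_def]
  have "eta_inverse M 0 = 0 \<and> (\<exists>r>0. eta_inverse M holomorphic_on ball 0 r \<and>
     (\<forall>z \<in> ball 0 r. eta_inverse M z \<in> ball 0 1 \<and> eta_transform M (eta_inverse M z) = z))" .
  then obtain e where "e > 0"
    "\<forall>z \<in> ball 0 e. eta_inverse M z \<in> ball 0 1 \<and> eta_transform M (eta_inverse M z) = z"
    by blast
  then show "\<forall>\<^sub>F z in nhds 0. eta_inverse M z \<in> ball 0 1 \<and> eta_transform M (eta_inverse M z) = z"
    unfolding eventually_nhds by (intro exI[of _ "ball 0 e"]) simp
qed

lemma eta_transform_exists:
  assumes w: "w holomorphic_on ball 0 1" "w ` ball 0 1 \<subseteq> ball 0 1" "w 0 = 0"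
  obtains M where "M \<in> circle_prob" "\<And>z. z \<in> ball 0 1 \<Longrightarrow> eta_transform M z = w z"
proof -
  have w1: "norm (w z) < 1" if "norm z < 1" for z
    using w(2) that by (auto simp: image_subset_iff)
  then have nz: "1 - w z \<noteq> 0" if "norm z < 1" for z
    using that by (metis eq_iff_diff_eq_0 less_irrefl norm_one)
  obtain M where M: "M \<in> circle_prob"
    "\<And>z. norm z < 1 \<Longrightarrow> (\<integral>s. (1 + z * s) / (1 - z * s) \<partial>M) = (1 + w z) / (1 - w z)"
  proof (rule Herglotz_representation)
    show "(\<lambda>z. (1 + w z) / (1 - w z)) holomorphic_on ball 0 1"
      using w nz by (intro holomorphic_intros) auto
    show "Re ((1 + w z) / (1 - w z)) \<ge> 0" if "norm z < 1" for z
    proof -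
      have "(Re (w z))\<^sup>2 + (Im (w z))\<^sup>2 \<le> 1"
        using w1[OF that] by (simp add: power_le_one flip: cmod_power2)
      \<comment> \<open>This is 1 - |w z|^2, in the shape of the numerator that
        \<open>Re_divide\<close> produces.\<close>
      then have "0 \<le> (1 + Re (w z)) * (1 - Re (w z)) - Im (w z) * Im (w z)"
        by (simp add: power2_eq_square algebra_simps)
      then show ?thesis by (simp add: Re_divide divide_nonneg_nonneg)
    qed
  qed (use w in auto)
  show thesis
  proof (rule that[OF M(1)])
    fix z :: complex assume "z \<in> ball 0 1"
    then have z: "norm z < 1" by simp
    interpret prob_space M by (rule circle_prob_prob_space[OF M(1)])
    have zs: "1 - z * s \<noteq> 0" if "norm s = 1" for s
      using one_minus_mult_neq_0[OF z] that by simp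
    \<comment> \<open>The Herglotz integral is 1 + 2 psi, and (1 + w)/(1 - w) = 1 + 2 w/(1 - w);
      comparison gives psi = w/(1 - w), that is, eta = w.\<close>
    have "(\<integral>s. 1 + 2 * (z * s / (1 - z * s)) \<partial>M) = (\<integral>s. (1 + z * s) / (1 - z * s) \<partial>M)"
      by (rule Bochner_Integration.integral_cong)
         (use zs in \<open>auto simp: circle_prob_space[OF M(1)] field_simps\<close>)
    moreover have "(\<integral>s. 1 + 2 * (z * s / (1 - z * s)) \<partial>M) = 1 + 2 * psi_transform M z"
      unfolding psi_transform_def
      by (subst Bochner_Integration.integral_add)
         (use zs in \<open>auto simp: prob_space simp del: times_divide_eq_right intro!: circle_prob_integrable[OF M(1)] continuous_intros\<close>)
    moreover have "(\<integral>s. (1 + z * s) / (1 - z * s) \<partial>M) = 1 + 2 * (w z / (1 - w z))"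
      using M(2)[OF z] nz[OF z] by (simp add: field_simps)
    ultimately have "2 * psi_transform M z = 2 * (w z / (1 - w z))"
      by (metis add_left_cancel)
    then have "psi_transform M z = w z / (1 - w z)"
      by (metis mult_cancel_left zero_neq_numeral)
    moreover have "1 + w z / (1 - w z) = 1 / (1 - w z)"
      using nz[OF z] by (simp add: field_simps)
    ultimately show "eta_transform M z = w z"
      using nz[OF z] by (simp add: eta_transform_def)
  qed
qed

section \<open>Inverting \<open>Phi\<close> on the disc\<close>

text \<open>Conjugation by a disc automorphism moves \<open>p\<close> to 0. A second fixed point
  then gives equality in the Schwarz lemma, which forces the identity map; the point
  \<open>c\<close> excludes this.\<close>

lemma fixed_point_unique_disc:
  fixes f :: "complex \<Rightarrow> complex"
  assumes f: "f holomorphic_on ball 0 1" "f ` ball 0 1 \<subseteq> ball 0 1"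
    and not_id: "c \<in> ball 0 1" "f c \<noteq> c"
    and p: "p \<in> ball 0 1" "f p = p" and q: "q \<in> ball 0 1" "f q = q"
  shows "p = q"
proof (rule ccontr)
  assume "p \<noteq> q"
  define M where "M = Moebius_function 0 p"
  define L where "L = Moebius_function 0 (- p)"
  have M: "M holomorphic_on ball 0 1" "M ` ball 0 1 \<subseteq> ball 0 1"
    and L: "L holomorphic_on ball 0 1" "L ` ball 0 1 \<subseteq> ball 0 1"
    using p Moebius_function_norm_lt_1[of p] Moebius_function_norm_lt_1[of "- p"]
    by (auto simp: M_def L_def intro: Moebius_function_holomorphic)
  have LM: "L (M z) = z" "M (L z) = z" if "z \<in> ball 0 1" for z
    using that p Moebius_function_compose[of "-p" p z] Moebius_function_compose[of p "-p" z]
    by (auto simp: M_def L_def)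
  have Mp: "M p = 0" and L0: "L 0 = p"
    by (simp_all add: M_def L_def Moebius_function_eq_zero Moebius_function_of_zero)
  define h where "h = (\<lambda>z. M (f (L z)))"
  have hol: "h holomorphic_on ball 0 1"
    unfolding h_def using M L f
    by (intro holomorphic_on_compose_gen[OF _ M(1), unfolded o_def]
        holomorphic_on_compose_gen[OF L(1) f(1), unfolded o_def]) blast+
  have h: "h z \<in> ball 0 1" if "z \<in> ball 0 1" for z
    using that M L f unfolding h_def by blast
  have "M q \<in> ball 0 1" using M q by blast
  moreover have hq: "h (M q) = M q" using LM q by (simp add: h_def)
  moreover have "M q \<noteq> 0" using LM(1)[OF q(1)] L0 \<open>p \<noteq> q\<close> by metis
  ultimately have "\<exists>z. norm z < 1 \<and> z \<noteq> 0 \<and> norm (h z) = norm z"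
    by (intro exI[of _ "M q"]) simp
  moreover have "h 0 = 0" using p by (simp add: h_def L0 Mp)
  moreover have "norm (h z) < 1" if "norm z < 1" for z using h that by simp
  ultimately obtain \<alpha> where \<alpha>: "\<And>z. norm z < 1 \<Longrightarrow> h z = \<alpha> * z"
    using Schwarz_Lemma(3)[OF hol, of 0] by auto
  with hq \<open>M q \<in> ball 0 1\<close> \<open>M q \<noteq> 0\<close> have "\<alpha> = 1" by (metis mem_ball_0 mult_cancel_right1)
  have "M c \<in> ball 0 1" "f c \<in> ball 0 1" using M f not_id by blast+
  then have "h (M c) = M c" using \<alpha> \<open>\<alpha> = 1\<close> by auto
  then have "M (f c) = M c" using LM not_id by (simp add: h_def)
  then show False using LM(1) \<open>f c \<in> ball 0 1\<close> not_id by metis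
qed

text \<open>The solutions of \<open>Phi u t w = z\<close> are the fixed points of \<open>w \<mapsto> z exp (- (t - 1) u w)\<close>, which maps
  the disc into the disc of radius \<open>|z|\<close>.\<close>

locale Re_nonneg_on_disc =
  fixes u :: "complex \<Rightarrow> complex"
  assumes hol: "u holomorphic_on ball 0 1" and Re_nonneg: "z \<in> ball 0 1 \<Longrightarrow> Re (u z) \<ge> 0"
begin

lemma Phi_holomorphic: "Phi u t holomorphic_on ball 0 1"
  unfolding Phi_def by (intro holomorphic_intros hol)

lemma norm_fixed_point_map_le:
  assumes "t \<ge> 1" "w \<in> ball 0 1"
  shows "norm (z * exp (- (of_real (t - 1) * u w))) \<le> norm z"
  using Re_nonneg[OF assms(2)] assms(1) by (simp add: norm_mult mult_left_le)

lemma Phi_eq_iff: "Phi u t w = z \<longleftrightarrow> z * exp (- (of_real (t - 1) * u w)) = w"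
proof -
  have "w * exp a = z \<longleftrightarrow> z * exp (- a) = w" for a
    by (auto simp: exp_minus field_simps)
  then show ?thesis unfolding Phi_def .
qed

text \<open>Points with the same value z are fixed points of the same map. The restriction to values
  in the disc gives |z| < 1, which makes that map a self-map of the disc.\<close>

lemma inj_on_Phi:
  assumes t: "t \<ge> 1"
  shows "inj_on (Phi u t) {w \<in> ball 0 1. Phi u t w \<in> ball 0 1}"
proof (rule inj_onI, clarify)
  fix p q assume pq: "p \<in> ball 0 1" "q \<in> ball 0 1" "Phi u t p \<in> ball 0 1"
    and eq: "Phi u t p = Phi u t q"
  define z where "z = Phi u t p"
  have z: "norm z < 1" using pq by (simp add: z_def)
  have le: "norm (z * exp (- (of_real (t - 1) * u w))) \<le> norm z" if "w \<in> ball 0 1" for w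
    using norm_fixed_point_map_le[OF t that] .
  \<comment> \<open>A point with |z| < |c| < 1 cannot be fixed, since its image has norm at most
    |z|; so the map is not the identity.\<close>
  define c where "c = complex_of_real ((norm z + 1) / 2)"
  have "norm c = (norm z + 1) / 2" unfolding c_def norm_of_real by simp
  then have c: "norm c < 1" "norm z < norm c" using z by simp_all
  show "p = q"
  proof (rule fixed_point_unique_disc)
    show "(\<lambda>w. z * exp (- (of_real (t - 1) * u w))) holomorphic_on ball 0 1" by (intro holomorphic_intros hol)
    show "(\<lambda>w. z * exp (- (of_real (t - 1) * u w))) ` ball 0 1 \<subseteq> ball 0 1"
      using order.strict_trans1[OF le z] by auto
    show "c \<in> ball 0 1" using c by simp
    show "z * exp (- (of_real (t - 1) * u c)) \<noteq> c" using le[of c] c by auto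
    show "z * exp (- (of_real (t - 1) * u p)) = p" "z * exp (- (of_real (t - 1) * u q)) = q"
      unfolding Phi_eq_iff[symmetric] using eq by (simp_all add: z_def)
  qed (use pq in auto)
qed

text \<open>The fixed-point map preserves the closed disc of radius |z|, a compact convex subset of
  the open unit disc, so Brouwer's theorem applies.\<close>

lemma Phi_surj:
  assumes t: "t \<ge> 1" and z: "z \<in> ball 0 1"
  obtains w where "w \<in> ball 0 1" "Phi u t w = z"
proof -
  have sub: "cball 0 (norm z) \<subseteq> ball (0 :: complex) 1" using z by auto
  obtain w where "w \<in> cball 0 (norm z)" "z * exp (- (of_real (t - 1) * u w)) = w"
  proof (rule brouwer[of "cball 0 (norm z)" "\<lambda>w. z * exp (- (of_real (t - 1) * u w))"])
    show "continuous_on (cball 0 (norm z)) (\<lambda>w. z * exp (- (of_real (t - 1) * u w)))"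
      using continuous_on_subset[OF holomorphic_on_imp_continuous_on[OF hol] sub]
      by (intro continuous_intros)
    show "(\<lambda>w. z * exp (- (of_real (t - 1) * u w))) \<in> cball 0 (norm z) \<rightarrow> cball 0 (norm z)"
      using norm_fixed_point_map_le[OF t] sub by auto
  qed auto
  then show thesis using that[of w] sub by (auto simp: Phi_eq_iff)
qed

text \<open>Brouwer's theorem says nothing about how the solution depends on z. Holomorphy comes
  from inverting the injective \<open>Phi u t\<close> on the open preimage of the disc.\<close>

lemma Phi_right_inverse:
  assumes t: "t \<ge> 1"
  obtains w where "w holomorphic_on ball 0 1" "w ` ball 0 1 \<subseteq> ball 0 1"
    "\<And>z. z \<in> ball 0 1 \<Longrightarrow> Phi u t (w z) = z"
proof -
  define S where "S = {w \<in> ball 0 1. Phi u t w \<in> ball 0 1}"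
  have holS: "Phi u t holomorphic_on ball 0 1" by (rule Phi_holomorphic)
  have "open S"
    using continuous_open_preimage[OF holomorphic_on_imp_continuous_on[OF holS] open_ball open_ball, of 0 1]
    by (simp add: S_def vimage_def Int_def)
  moreover have "Phi u t holomorphic_on S"
    using holS by (rule holomorphic_on_subset) (auto simp: S_def)
  moreover have "inj_on (Phi u t) S" unfolding S_def by (rule inj_on_Phi[OF t])
  ultimately obtain w where w: "w holomorphic_on Phi u t ` S"
    "\<And>z. z \<in> S \<Longrightarrow> w (Phi u t z) = z"
    using holomorphic_has_inverse by metis
  have im: "\<exists>x\<in>S. Phi u t x = z" if "z \<in> ball 0 1" for z
    using Phi_surj[OF t that] that unfolding S_def by blast
  then have "Phi u t ` S = ball 0 1" by (force simp: S_def)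
  with w have hol_w: "w holomorphic_on ball 0 1" by simp
  moreover have "w z \<in> S \<and> Phi u t (w z) = z" if "z \<in> ball 0 1" for z
    using im[OF that] w(2) by force
  ultimately show thesis using that unfolding S_def by blast
qed

end

section \<open>Free convolution of the measures with inverse \<open>Phi\<close>\<close>

context Re_nonneg_on_disc
begin

text \<open>The measures nu_t of the overview, as a relation: it covers both the measure obtained
  from the given omega_t and those obtained from \<open>Phi_right_inverse\<close>.\<close>

definition Phi_measure :: "real \<Rightarrow> complex measure \<Rightarrow> bool" where
  "Phi_measure t M \<longleftrightarrow> M \<in> circle_prob \<and>
     (\<forall>z \<in> ball 0 1. eta_transform M z \<in> ball 0 1 \<and> Phi u t (eta_transform M z) = z)"

text \<open>The first moment is eta'(0); if it were 0, differentiating Phi(eta(z)) = z at 0 would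
  give 0 = 1.\<close>

lemma Phi_measure_first_moment:
  assumes "Phi_measure t M"
  shows "first_moment M \<noteq> 0"
proof
  assume 0: "first_moment M = 0"
  have M: "M \<in> circle_prob" and inv: "\<And>z. z \<in> ball 0 1 \<Longrightarrow> Phi u t (eta_transform M z) = z"
    using assms by (auto simp: Phi_measure_def)
  have "(Phi u t has_field_derivative deriv (Phi u t) 0) (at (eta_transform M 0))"
    unfolding eta_transform_0 by (intro holomorphic_derivI[OF Phi_holomorphic]) auto
  from DERIV_chain2[OF this eta_deriv_0[OF M]]
  have "((\<lambda>z. Phi u t (eta_transform M z)) has_field_derivative 0) (at 0)" by (simp add: 0)
  then have "((\<lambda>z. z) has_field_derivative (0 :: complex)) (at 0)"
    by (rule has_field_derivative_transform_within_open[of _ _ _ "ball 0 1"]) (auto simp: inv)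
  then show False using DERIV_unique[OF DERIV_ident] by fastforce
qed

lemma Phi_measure_exists:
  assumes "t > 1"
  obtains M where "Phi_measure t M"
proof -
  obtain w where w: "w holomorphic_on ball 0 1" "w ` ball 0 1 \<subseteq> ball 0 1"
    "\<And>z. z \<in> ball 0 1 \<Longrightarrow> Phi u t (w z) = z"
    using Phi_right_inverse[of t] assms by auto
  have "w 0 = 0" using w(3)[of 0] by (simp add: Phi_def)
  then obtain M where M: "M \<in> circle_prob" "\<And>z. z \<in> ball 0 1 \<Longrightarrow> eta_transform M z = w z"
    using eta_transform_exists[OF w(1,2)] by metis
  show thesis
    by (rule that[of M]) (use w(2,3) M in \<open>simp add: Phi_measure_def image_subset_iff\<close>)
qed

text \<open>Apply Phi(eta(x)) = x at x = \<open>eta_inverse M z\<close>, where eta(x) = z: whatever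
  inverse was chosen, it agrees with \<open>Phi u t\<close> near 0.\<close>

lemma Phi_measure_Sigma:
  assumes "Phi_measure t M"
  shows "\<forall>\<^sub>F z in at 0. Sigma_transform M z = exp (of_real (t - 1) * u z)"
proof -
  have "\<forall>\<^sub>F z in nhds 0. eta_inverse M z \<in> ball 0 1 \<and> eta_transform M (eta_inverse M z) = z"
    using eta_inverse_right_inverse Phi_measure_first_moment[OF assms] assms
    unfolding Phi_measure_def by blast
  then have "\<forall>\<^sub>F z in nhds 0. eta_inverse M z = Phi u t z"
    by eventually_elim (use assms in \<open>metis Phi_measure_def\<close>)
  then have "\<forall>\<^sub>F z in at 0. eta_inverse M z = Phi u t z"
    by (simp add: eventually_at_filter eventually_mono)
  moreover have "\<forall>\<^sub>F z in at (0 :: complex). z \<noteq> 0"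
    by (simp add: eventually_at_filter)
  ultimately show ?thesis
    by eventually_elim (simp add: Sigma_transform_def Phi_def)
qed

text \<open>The Sigma-transform makes \<open>Phi u t\<close> a right inverse of the eta-transform of
  \<open>R\<close> near 0. Substituting the eta-transform of \<open>M\<close>, which tends to 0 at 0
  and is undone by \<open>Phi u t\<close>, identifies the two eta-transforms.\<close>

lemma Phi_measure_unique:
  assumes M: "Phi_measure t M" and R: "R \<in> circle_prob" "first_moment R \<noteq> 0"
    and Sigma: "\<forall>\<^sub>F z in at 0. Sigma_transform R z = exp (of_real (t - 1) * u z)"
  shows "R = M"
proof -
  have "\<forall>\<^sub>F z in nhds 0. z \<noteq> 0 \<longrightarrow> Sigma_transform R z = exp (of_real (t - 1) * u z)"
    using Sigma by (simp add: eventually_at_filter)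
  then have "\<forall>\<^sub>F z in nhds 0. eta_transform R (Phi u t z) = z"
    using eta_inverse_right_inverse[OF R]
  proof eventually_elim
    case (elim z)
    then show ?case
      \<comment> \<open>The Sigma-transform gives no information at 0 itself, where both functions
        vanish.\<close>
      by (cases "z = 0") (auto simp: Phi_def Sigma_transform_def eta_transform_0 field_simps)
  qed
  moreover have "filterlim (eta_transform M) (nhds 0) (nhds 0)"
    using DERIV_isCont[OF eta_deriv_0[of M]] M tendsto_at_iff_tendsto_nhds[of "eta_transform M" 0]
    by (simp add: Phi_measure_def isCont_def eta_transform_0)
  ultimately have "\<forall>\<^sub>F z in nhds 0. eta_transform R (Phi u t (eta_transform M z)) = eta_transform M z"
    by (rule eventually_compose_filterlim)
  moreover have "\<forall>\<^sub>F z in nhds 0. z \<in> ball (0 :: complex) 1"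
    by (intro eventually_nhds_in_open) auto
  ultimately have "\<forall>\<^sub>F z in nhds 0. eta_transform R z = eta_transform M z"
    by eventually_elim (use M in \<open>simp add: Phi_measure_def\<close>)
  with R M show ?thesis by (intro circle_prob_eqI_eta) (auto simp: Phi_measure_def)
qed

text \<open>The exponents t - 1 add under multiplication of Sigma-transforms, hence the parameters
  of the form 1 + a. \<open>C\<close> provides the existence part of the definite
  description.\<close>

lemma free_mult_conv_Phi_measure:
  assumes A: "Phi_measure (1 + a) A" and B: "Phi_measure (1 + b) B" and C: "Phi_measure (1 + (a + b)) C"
  shows "A \<boxtimes> B = C"
proof -
  have prod: "\<forall>\<^sub>F z in at 0. Sigma_transform A z * Sigma_transform B z = exp (of_real (1 + (a + b) - 1) * u z)"
    using Phi_measure_Sigma[OF A] Phi_measure_Sigma[OF B]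
    by eventually_elim (simp add: distrib_right exp_add)
  show ?thesis
    unfolding free_mult_conv_def
  proof (rule the_equality)
    have "\<forall>\<^sub>F z in at 0. Sigma_transform C z = Sigma_transform A z * Sigma_transform B z"
      using Phi_measure_Sigma[OF C] prod by eventually_elim simp
    then show "C \<in> circle_prob \<and> first_moment C \<noteq> 0 \<and>
        (\<forall>\<^sub>F z in at 0. Sigma_transform C z = Sigma_transform A z * Sigma_transform B z)"
      using Phi_measure_first_moment[OF C] C by (simp add: Phi_measure_def)
  next
    fix R assume R: "R \<in> circle_prob \<and> first_moment R \<noteq> 0 \<and>
        (\<forall>\<^sub>F z in at 0. Sigma_transform R z = Sigma_transform A z * Sigma_transform B z)"
    then have "\<forall>\<^sub>F z in at 0. Sigma_transform R z = Sigma_transform A z * Sigma_transform B z" by blast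
    with prod have "\<forall>\<^sub>F z in at 0. Sigma_transform R z = exp (of_real (1 + (a + b) - 1) * u z)"
      by eventually_elim simp
    with R show "R = C" by (intro Phi_measure_unique[OF C]) auto
  qed
qed

text \<open>Applying the operator j times to \<open>R\<close> gives j + 1 factors. \<open>M\<close>
  is arbitrary in the induction because the step uses the hypothesis for a smaller product
  \<open>N\<close>.\<close>

lemma free_mult_conv_power_Phi_measure:
  assumes R: "Phi_measure (1 + a) R" and a: "a > 0"
  shows "Phi_measure (1 + (real j + 1) * a) M \<Longrightarrow> (((\<boxtimes>) R) ^^ j) R = M"
proof (induction j arbitrary: M)
  case 0
  have "M \<in> circle_prob" "first_moment M \<noteq> 0"
    using 0 Phi_measure_first_moment by (auto simp: Phi_measure_def)
  with Phi_measure_Sigma[OF 0] have "M = R" by (intro Phi_measure_unique[OF R]) simp_all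
  then show ?case by simp
next
  case (Suc j)
  have "1 + (real j + 1) * a > 1" using a by simp
  then obtain N where N: "Phi_measure (1 + (real j + 1) * a) N" by (rule Phi_measure_exists)
  have "Phi_measure (1 + (a + (real j + 1) * a)) M"
    using Suc.prems by (simp add: algebra_simps)
  then show ?case
    using Suc.IH[OF N] free_mult_conv_Phi_measure[OF R N] by simp
qed

lemma Phi_measure_inf_divisible:
  assumes M: "Phi_measure t M" and t: "t > 1"
  shows "free_mult_inf_divisible M"
  unfolding free_mult_inf_divisible_def
proof (intro allI impI)
  fix n :: nat assume n: "n \<ge> 1"
  \<comment> \<open>The n factors share the exponent t - 1 equally; the n-fold product then has
    parameter 1 + n a = t.\<close>
  define a where "a = (t - 1) / real n"
  have a: "a > 0" using n t by (simp add: a_def)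
  then obtain R where R: "Phi_measure (1 + a) R" using Phi_measure_exists[of "1 + a"] by auto
  have "1 + (real (n - 1) + 1) * a = t" using n by (simp add: a_def of_nat_diff)
  then have "((\<boxtimes>) R ^^ (n - 1)) R = M"
    using free_mult_conv_power_Phi_measure[OF R a, of "n - 1" M] M by simp
  then show "\<exists>R\<in>circle_prob. first_moment R \<noteq> 0 \<and> M = ((\<boxtimes>) R ^^ (n - 1)) R"
    using R Phi_measure_first_moment[OF R] by (auto simp: Phi_measure_def)
qed

end

theorem proposition4p1:
  fixes \<mu> :: "complex measure" and t :: real and u \<omega> :: "complex \<Rightarrow> complex"
  assumes "\<mu> \<in> circle_prob_times" and "t > 1"
    and "eta_exponent \<mu> u" and "is_omega u t \<omega>"
  shows "\<exists>\<nu> \<in> circle_prob_times. free_mult_inf_divisible \<nu> \<and>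
           (\<forall>z \<in> ball 0 1. eta_transform \<nu> z = \<omega> z)"
proof -
  interpret Re_nonneg_on_disc u
    using assms(3) by unfold_locales (auto simp: eta_exponent_def)
  have \<omega>: "\<omega> holomorphic_on ball 0 1" "\<omega> ` ball 0 1 \<subseteq> ball 0 1" "\<omega> 0 = 0"
    "\<And>z. z \<in> ball 0 1 \<Longrightarrow> Phi u t (\<omega> z) = z"
    using assms(4) by (auto simp: is_omega_def)
  obtain \<nu> where \<nu>: "\<nu> \<in> circle_prob" "\<And>z. z \<in> ball 0 1 \<Longrightarrow> eta_transform \<nu> z = \<omega> z"
    using eta_transform_exists[OF \<omega>(1-3)] by metis
  have P: "Phi_measure t \<nu>"
    using \<nu> \<omega> by (auto simp: Phi_measure_def image_subset_iff)
  \<comment> \<open>A zero of \<omega> at z would give z = \<open>Phi u t 0\<close> = 0.\<close>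
  have "\<omega> z \<noteq> 0" if "z \<in> ball 0 1 - {0}" for z
    using \<omega>(4)[of z] that by (auto simp: Phi_def)
  then have "\<nu> \<in> circle_prob_times"
    using \<nu> Phi_measure_first_moment[OF P] by (auto simp: circle_prob_times_def)
  with \<nu>(2) Phi_measure_inf_divisible[OF P \<open>t > 1\<close>] show ?thesis by blast
qed

end
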